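(* Let $X$ be an equiangular set with angle $\frac15$ and base size $K(X)=3$ in $\mathbb{R}^r$. Then $$|X| \leq \max\{165,\ r+6\}.$$
   Context: Equiangular set: a finite set $X=\{x_1,\dots,x_s\}$ of unit vectors in $\mathbb{R}^r$ is equiangular with angle $\alpha\in[0,1)$ if $\langle x_i,x_j\rangle\in\{-\alpha,\alpha\}$ for all $i\neq j$. For Gram matrices write $G\simeq G'$ if $G'=(CB)^{T}G(CB)$ with $B$ a diagonal $\pm1$ matrix and $C$ a permutation matrix. $I$ is the identity and $J$ the all-one matrix. Base size: $K(X)$ is the largest $k$ for which there are $p_1,\dots,p_k\in X$ whose Gram matrix satisfies $G(p_1,\dots,p_k)\simeq(1+\alpha)I-\alpha J$; equivalently, the largest $k$ such that, after replacing some vectors of $X$ by their negatives, there are $k$ vectors with pairwise inner products $-\alpha$. *)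

theory Defs
  imports "HOL-Analysis.Analysis" "Jordan_Normal_Form.Matrix"
begin

text \<open>Vectors of Euclidean space live in the type \<open>real ^ 'n\<close>; matrices whose size varies
  inside a formula (Gram matrices) are matrices \<open>real mat\<close> of Jordan-Normal-Form. Both libraries
  define \<open>mat\<close>, hence the qualified name \<open>Matrix.mat\<close> below.\<close>

definition equiangular :: "real \<Rightarrow> (real ^ 'n) set \<Rightarrow> bool" where
  "equiangular \<alpha> X \<longleftrightarrow>
     0 \<le> \<alpha> \<and> \<alpha> < 1 \<and> finite X \<and> (\<forall>x\<in>X. norm x = 1) \<and>
     (\<forall>x\<in>X. \<forall>y\<in>X. x \<noteq> y \<longrightarrow> inner x y \<in> {- \<alpha>, \<alpha>})"

definition gram_mat :: "(real ^ 'n) list \<Rightarrow> real mat" where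
  "gram_mat ps = Matrix.mat (length ps) (length ps) (\<lambda>(i, j). inner (ps ! i) (ps ! j))"

definition signed_diagonal_mat :: "nat \<Rightarrow> real mat \<Rightarrow> bool" where
  "signed_diagonal_mat k B \<longleftrightarrow>
     B \<in> carrier_mat k k \<and> diagonal_mat B \<and> (\<forall>i<k. B $$ (i, i) \<in> {- 1, 1})"

definition permutation_mat :: "nat \<Rightarrow> real mat \<Rightarrow> bool" where
  "permutation_mat k C \<longleftrightarrow>
     (\<exists>\<pi>. bij_betw \<pi> {..<k} {..<k} \<and> C = Matrix.mat k k (\<lambda>(i, j). if i = \<pi> j then 1 else 0))"

definition gram_equiv :: "real mat \<Rightarrow> real mat \<Rightarrow> bool" where
  "gram_equiv G G' \<longleftrightarrow>
     (\<exists>k B C. G \<in> carrier_mat k k \<and> signed_diagonal_mat k B \<and> permutation_mat k C \<and>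
        G' = transpose_mat (C * B) * G * (C * B))"

definition all_ones_mat :: "nat \<Rightarrow> real mat" where
  "all_ones_mat k = Matrix.mat k k (\<lambda>_. 1)"

text \<open>A list \<open>ps\<close> below cannot repeat a vector when \<open>X\<close> is equiangular with angle \<open>\<alpha> < 1\<close>, since the
  off-diagonal Gram entries are then \<open>\<plusminus>\<alpha> \<noteq> 1\<close>. So the lengths are bounded by \<open>card X\<close>, and as the
  empty list is admissible, the maximum is over a finite nonempty set. The angle is an explicit
  argument because \<open>X\<close> does not determine it when it has at most one element.\<close>

definition base_size :: "real \<Rightarrow> (real ^ 'n) set \<Rightarrow> nat" where
  "base_size \<alpha> X =
     Max {k. \<exists>ps. length ps = k \<and> set ps \<subseteq> X \<and>
            gram_equiv (gram_mat ps) ((1 + \<alpha>) \<cdot>\<^sub>m 1\<^sub>m k - \<alpha> \<cdot>\<^sub>m all_ones_mat k)}"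

end

theory Submission
  imports Defs
begin

text \<open>
  Let \<open>S\<close> consist of the vectors of \<open>X\<close> and their negatives; its cardinality is twice that of \<open>X\<close>.
  Base size 3 gives \<open>p1, p2, p3 \<in> S\<close> with pairwise inner products \<open>- 1/5\<close>, and forbids four such
  vectors. Hence the signs of the inner products of any further line of \<open>X\<close> with \<open>p1, p2, p3\<close> are
  not all equal, so up to negation exactly two of them are negative. For two base vectors \<open>p, q\<close> the pillar
  over \<open>p, q\<close> is the set of those \<open>x\<close> which have inner product \<open>- 1/5\<close> with both. The three pillars
  thus meet every line (\<open>card_le\<close>), and if each of them has at most 55 elements, then
  \<open>card X \<le> 3 * 55 = 165\<close>.

  Suppose now that the pillar \<open>V\<close> over \<open>p, q\<close> has \<open>m \<ge> 56\<close> elements. Two elements of \<open>V\<close> have inner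
  product \<open>1/5\<close>, as otherwise they would form a forbidden quadruple with \<open>p, q\<close>. Hence \<open>V\<close> is close to
  a regular simplex, which restricts all other vectors through a Bessel inequality
  (\<open>bessel_constant_inner\<close>). First, a vector \<open>y\<close> outside of \<open>V\<close> and \<open>- V\<close> has at most four inner
  products of one of the two signs with \<open>V\<close> (\<open>few_of_one_sign\<close>). Choose its sign such that at most
  four are positive. The inner products of \<open>y\<close> with \<open>p\<close> and \<open>q\<close> have different signs, so \<open>y\<close> falls into
  one of two classes. Secondly, each class has at most four elements (\<open>card_side_le_4\<close>). Otherwise
  take \<open>p\<close> and five elements of the class. On combinations with nonnegative weights, the squared
  distance to the span of \<open>V\<close> would be bounded, up to scaling and a small error, by the form
  \<open>4 I - 2 A\<close>, where \<open>A\<close> is the adjacency matrix of a star with centre \<open>p\<close> and five leaves. But the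
  largest eigenvalue of \<open>A\<close> is \<open>sqrt 5 > 2\<close>, with a positive eigenvector.

  So the elements of \<open>S\<close> lie on at most \<open>m + 8\<close> lines. Since \<open>V \<union> {p, q}\<close> is linearly independent,
  \<open>m + 2\<close> is at most the dimension (\<open>card_pillar_le_dim\<close>), and \<open>card X \<le> (r - 2) + 8 = r + 6\<close> in
  dimension \<open>r\<close>.
\<close>

section \<open>Vectors with constant pairwise inner product\<close>

lemma inner_sum_constant_inner:
  fixes V :: "'a::real_inner set"
  assumes "finite V" and unit: "\<And>x. x \<in> V \<Longrightarrow> inner x x = 1"
    and pair: "\<And>x y. x \<in> V \<Longrightarrow> y \<in> V \<Longrightarrow> x \<noteq> y \<Longrightarrow> inner x y = a"
  shows "inner (\<Sum>x\<in>V. c x *\<^sub>R x) (\<Sum>x\<in>V. c x *\<^sub>R x)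
           = (1 - a) * (\<Sum>x\<in>V. (c x)\<^sup>2) + a * (\<Sum>x\<in>V. c x)\<^sup>2"
proof -
  have row: "(\<Sum>y\<in>V. c y * inner x y) = (1 - a) * c x + a * (\<Sum>y\<in>V. c y)" if "x \<in> V" for x
  proof -
    have "(\<Sum>y\<in>V. c y * inner x y) = (\<Sum>y\<in>V. a * c y + (if y = x then (1 - a) * c x else 0))"
      using that unit pair by (intro sum.cong) (auto simp: algebra_simps)
    then show ?thesis
      using that \<open>finite V\<close> by (simp add: sum.distrib sum_distrib_left)
  qed
  have "inner (\<Sum>x\<in>V. c x *\<^sub>R x) (\<Sum>x\<in>V. c x *\<^sub>R x) = (\<Sum>x\<in>V. c x * (\<Sum>y\<in>V. c y * inner x y))"
    by (simp add: inner_sum_left inner_sum_right inner_commute sum_distrib_left mult_ac)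
  also have "\<dots> = (\<Sum>x\<in>V. (1 - a) * (c x)\<^sup>2 + a * (\<Sum>y\<in>V. c y) * c x)"
    by (intro sum.cong refl, subst row) (simp_all add: algebra_simps power2_eq_square)
  also have "\<dots> = (1 - a) * (\<Sum>x\<in>V. (c x)\<^sup>2) + a * (\<Sum>x\<in>V. c x)\<^sup>2"
    by (simp add: sum.distrib sum_distrib_left[symmetric] power2_eq_square)
  finally show ?thesis .
qed

text \<open>Bessel's inequality for a non-orthogonal system: the difference of the two sides is
  \<open>1 - a\<close> times the squared distance from \<open>w\<close> to the span of \<open>V\<close>. It comes from inverting the Gram
  matrix \<open>(1 - a) I + a J\<close>, whose inverse is again a combination of \<open>I\<close> and \<open>J\<close>.\<close>

lemma bessel_constant_inner:
  fixes V :: "'a::real_inner set"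
  assumes "finite V" and unit: "\<And>x. x \<in> V \<Longrightarrow> inner x x = 1"
    and pair: "\<And>x y. x \<in> V \<Longrightarrow> y \<in> V \<Longrightarrow> x \<noteq> y \<Longrightarrow> inner x y = a"
    and "0 \<le> a" "a < 1"
  shows "(\<Sum>x\<in>V. (inner w x)\<^sup>2) - a * (\<Sum>x\<in>V. inner w x)\<^sup>2 / (1 - a + a * card V)
           \<le> (1 - a) * inner w w"
proof -
  define m where "m = real (card V)"
  define C where "C = (\<Sum>x\<in>V. inner w x)"
  define Q where "Q = (\<Sum>x\<in>V. (inner w x)\<^sup>2)"
  define h where "h = a * C / (1 - a + a * m)"
  have "0 < 1 - a + a * m"
    using assms(4,5) by (simp add: add_pos_nonneg m_def)
  then have h: "a * C = h * (1 - a + a * m)"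
    by (simp add: h_def)
  define c where "c x = inner w x - h" for x
  let ?p = "\<Sum>x\<in>V. c x *\<^sub>R x"
  have c1: "(\<Sum>x\<in>V. c x) = C - m * h"
    by (simp add: c_def C_def m_def sum_subtractf)
  have c2: "(\<Sum>x\<in>V. (c x)\<^sup>2) = Q - 2 * h * C + m * h\<^sup>2"
    by (simp add: c_def C_def Q_def m_def power2_diff sum_subtractf sum.distrib
        sum_distrib_left mult_ac)
  have wp: "inner w ?p = Q - h * C"
    by (simp add: c_def C_def Q_def inner_sum_right power2_eq_square sum_subtractf
        sum_distrib_left algebra_simps)
  have pp: "inner ?p ?p = (1 - a) * (Q - 2 * h * C + m * h\<^sup>2) + a * (C - m * h)\<^sup>2"
    using inner_sum_constant_inner[OF assms(1) unit pair, of c] c1 c2 by simp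
  have "a * (C - m * h) = (1 - a) * h"
    using h by (simp add: algebra_simps)
  then have "a * (C - m * h)\<^sup>2 = (1 - a) * h * (C - m * h)"
    by (simp add: power2_eq_square mult.assoc[symmetric])
  with pp have pp: "inner ?p ?p = (1 - a) * (Q - h * C)"
    by (simp add: algebra_simps power2_eq_square)
  have "0 \<le> inner ((1 - a) *\<^sub>R w - ?p) ((1 - a) *\<^sub>R w - ?p)"
    by simp
  also have "\<dots> = (1 - a) * ((1 - a) * inner w w) - 2 * ((1 - a) * inner w ?p) + inner ?p ?p"
    by (simp add: inner_diff_left inner_diff_right inner_commute)
  also have "\<dots> = (1 - a) * ((1 - a) * inner w w - (Q - h * C))"
    unfolding wp pp by (simp add: algebra_simps)
  finally have "Q - h * C \<le> (1 - a) * inner w w"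
    using \<open>a < 1\<close> by (simp add: zero_le_mult_iff)
  then show ?thesis
    by (simp add: h_def C_def Q_def m_def power2_eq_square)
qed

section \<open>Lines of angle one fifth without four vectors at pairwise minus one fifth\<close>

lemma card_signed_cover:
  fixes S T :: "'a::group_add set"
  assumes "\<And>y. y \<in> S \<Longrightarrow> y \<in> T \<or> - y \<in> T" "finite T"
  shows "card S \<le> 2 * card T"
proof -
  have "S \<subseteq> T \<union> uminus ` T"
    using assms(1) by (metis UnCI image_eqI minus_minus subsetI)
  then have "card S \<le> card (T \<union> uminus ` T)"
    using assms(2) by (intro card_mono) auto
  also have "\<dots> \<le> card T + card (uminus ` T)" by (rule card_Un_le)
  also have "card (uminus ` T) \<le> card T" using assms(2) by (rule card_image_le)
  finally show ?thesis by simp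
qed

text \<open>It is convenient to work with a set closed under negation, that is, with both unit vectors of
  every line: switching signs then amounts to choosing other elements of the same set.\<close>

locale equiangular_fifth =
  fixes S :: "(real ^ 'n) set"
  assumes finite_S: "finite S"
    and uminus_S: "x \<in> S \<Longrightarrow> - x \<in> S"
    and unit_S: "x \<in> S \<Longrightarrow> inner x x = 1"
    and inner_S: "x \<in> S \<Longrightarrow> y \<in> S \<Longrightarrow> y \<noteq> x \<Longrightarrow> y \<noteq> - x \<Longrightarrow> inner x y = 1/5 \<or> inner x y = - 1/5"
    and no_quadruple: "\<lbrakk>w \<in> S; x \<in> S; y \<in> S; z \<in> S;
       inner w x = - 1/5; inner w y = - 1/5; inner w z = - 1/5;
       inner x y = - 1/5; inner x z = - 1/5; inner y z = - 1/5\<rbrakk> \<Longrightarrow> False"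
begin

definition pillar :: "real ^ 'n \<Rightarrow> real ^ 'n \<Rightarrow> (real ^ 'n) set" where
  "pillar p q = {x \<in> S. inner x p = - 1/5 \<and> inner x q = - 1/5}"

text \<open>The class of \<open>q\<close> among the vectors that separate \<open>p\<close> and \<open>q\<close>. The inner product with \<open>q\<close> is only
  required to be positive, instead of equal to \<open>1/5\<close>, so that \<open>q\<close> itself belongs to its class.\<close>

definition side :: "real ^ 'n \<Rightarrow> real ^ 'n \<Rightarrow> (real ^ 'n) set" where
  "side p q = {y \<in> S. inner y p = - 1/5 \<and> 0 < inner y q \<and>
                 card {x \<in> pillar p q. inner y x = 1/5} \<le> 4}"

lemma pillar_commute: "pillar p q = pillar q p"
  by (auto simp: pillar_def)

lemma finite_pillar: "finite (pillar p q)"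
  using finite_S by (simp add: pillar_def)

lemma inner_pillar:
  assumes "p \<in> S" "q \<in> S" "inner p q = - 1/5" "x \<in> pillar p q" "y \<in> pillar p q" "x \<noteq> y"
  shows "inner x y = 1/5"
proof -
  have "y \<noteq> - x" using assms(4,5) by (auto simp: pillar_def)
  then have "inner x y = 1/5 \<or> inner x y = - 1/5"
    using inner_S[of x y] assms by (auto simp: pillar_def)
  moreover have "inner x y \<noteq> - 1/5"
    using no_quadruple[of x y p q] assms by (auto simp: pillar_def)
  ultimately show ?thesis by simp
qed

lemma bessel_pillar:
  assumes "p \<in> S" "q \<in> S" "inner p q = - 1/5"
  shows "(\<Sum>x\<in>pillar p q. (5 * inner w x)\<^sup>2)
           - (\<Sum>x\<in>pillar p q. 5 * inner w x)\<^sup>2 / (card (pillar p q) + 4) \<le> 20 * inner w w"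
proof -
  have "(\<Sum>x\<in>pillar p q. (inner w x)\<^sup>2)
      - 1/5 * (\<Sum>x\<in>pillar p q. inner w x)\<^sup>2 / (1 - 1/5 + 1/5 * card (pillar p q))
      \<le> (1 - 1/5) * inner w w"
  proof (rule bessel_constant_inner[OF finite_pillar])
    show "inner x x = 1" if "x \<in> pillar p q" for x
      using that unit_S by (simp add: pillar_def)
    show "inner x y = 1/5" if "x \<in> pillar p q" "y \<in> pillar p q" "x \<noteq> y" for x y
      using inner_pillar[OF assms that] .
  qed simp_all
  moreover have "(\<Sum>x\<in>pillar p q. (5 * inner w x)\<^sup>2) = 25 * (\<Sum>x\<in>pillar p q. (inner w x)\<^sup>2)"
    by (simp add: power_mult_distrib sum_distrib_left)
  moreover have "(\<Sum>x\<in>pillar p q. 5 * inner w x) = 5 * (\<Sum>x\<in>pillar p q. inner w x)"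
    by (simp add: sum_distrib_left)
  ultimately show ?thesis
    by (simp add: power_mult_distrib field_simps)
qed

text \<open>With \<open>a\<close> positive and \<open>b\<close> negative inner products, Bessel's inequality for \<open>y\<close> becomes
  \<open>(a - 4) * (b - 4) \<le> 36\<close>. If \<open>a, b \<ge> 5\<close>, the left-hand side is at least \<open>a + b - 9\<close>, which is where
  the bound 46 comes from.\<close>

lemma few_of_one_sign:
  assumes "p \<in> S" "q \<in> S" "inner p q = - 1/5" "46 \<le> card (pillar p q)"
    and y: "inner y y = 1" "\<And>x. x \<in> pillar p q \<Longrightarrow> inner y x = 1/5 \<or> inner y x = - 1/5"
  shows "card {x \<in> pillar p q. inner y x = 1/5} \<le> 4 \<or> card {x \<in> pillar p q. inner y x = - 1/5} \<le> 4"
proof (rule ccontr)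
  let ?V = "pillar p q"
  let ?P = "{x \<in> ?V. inner y x = 1/5}" and ?N = "{x \<in> ?V. inner y x = - 1/5}"
  assume "\<not> ?thesis"
  then have "5 \<le> card ?P" "5 \<le> card ?N" by auto
  define a b where "a = real (card ?P)" and "b = real (card ?N)"
  have ab: "5 \<le> a" "5 \<le> b"
    using \<open>5 \<le> card ?P\<close> \<open>5 \<le> card ?N\<close> by (simp_all add: a_def b_def)
  have V: "?V = ?P \<union> ?N" "?P \<inter> ?N = {}" using y(2) by auto
  have fin: "finite ?P" "finite ?N" using finite_pillar by simp_all
  have "card ?V = card (?P \<union> ?N)" using V(1) by (rule arg_cong)
  also have "\<dots> = card ?P + card ?N" by (rule card_Un_disjoint[OF fin V(2)])
  finally have m: "real (card ?V) = a + b" by (simp add: a_def b_def)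
  have "(\<Sum>x\<in>?V. 5 * inner y x) = (\<Sum>x\<in>?P \<union> ?N. 5 * inner y x)"
    using V(1) by (rule arg_cong)
  also have "\<dots> = (\<Sum>x\<in>?P. 5 * inner y x) + (\<Sum>x\<in>?N. 5 * inner y x)"
    by (rule sum.union_disjoint[OF fin V(2)])
  also have "\<dots> = (\<Sum>x\<in>?P. 1) + (\<Sum>x\<in>?N. - 1)"
    by (intro arg_cong2[where f = "(+)"] sum.cong) auto
  finally have s1: "(\<Sum>x\<in>?V. 5 * inner y x) = a - b" by (simp add: a_def b_def)
  have "(5 * inner y x)\<^sup>2 = 1" if "x \<in> ?V" for x
    using y(2)[OF that] unfolding power2_eq_1_iff by auto
  then have "(\<Sum>x\<in>?V. (5 * inner y x)\<^sup>2) = (\<Sum>x\<in>?V. 1)"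
    by (intro sum.cong) simp_all
  then have s2: "(\<Sum>x\<in>?V. (5 * inner y x)\<^sup>2) = a + b" using m by simp
  have "a + b - (a - b)\<^sup>2 / (a + b + 4) \<le> 20"
    using bessel_pillar[OF assms(1-3), of y] unfolding s1 s2 y(1) of_nat_add m by simp
  then have "(a + b) * (a + b + 4) - (a - b)\<^sup>2 \<le> 20 * (a + b + 4)"
    using ab by (simp add: field_simps)
  then have "(a - 4) * (b - 4) \<le> 36"
    by (simp add: algebra_simps power2_eq_square)
  moreover have "0 \<le> (a - 5) * (b - 5)" using ab by simp
  moreover have "46 \<le> a + b" using m assms(4) by simp
  ultimately show False by (simp add: algebra_simps)
qed

text \<open>Bessel's inequality is applied to \<open>(5/2) p + y1 + \<dots> + y5\<close> with five elements \<open>yi\<close> of the side.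
  Modulo the span of a very large pillar, this vector would have negative squared norm. For \<open>m\<close>
  vectors in the pillar and \<open>s\<close> positive inner products between the \<open>yi\<close> and the pillar, the
  inequality reads \<open>m * (5 + s) \<le> s\<^sup>2 + 26 * s + 205\<close>. Since \<open>s \<le> 5 * 4\<close>, it fails for \<open>m \<ge> 56\<close>.\<close>

lemma card_side_le_4:
  assumes pq: "p \<in> S" "q \<in> S" "inner p q = - 1/5" and V56: "56 \<le> card (pillar p q)"
  shows "card (side p q) \<le> 4"
proof (rule ccontr)
  let ?V = "pillar p q"
  assume "\<not> ?thesis"
  then obtain F where F: "F \<subseteq> side p q" "card F = 5"
    by (metis not_less_eq_eq obtain_subset_with_card_n eval_nat_numeral(3))
  then have finF: "finite F" using card.infinite by fastforce
  have yS: "y \<in> S" "inner y p = - 1/5" "0 < inner y q"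
      "card {x \<in> ?V. inner y x = 1/5} \<le> 4" if "y \<in> F" for y
    using F that by (auto simp: side_def)
  have yV: "inner y x = 1/5 \<or> inner y x = - 1/5" if "y \<in> F" "x \<in> ?V" for x y
  proof -
    have "x \<noteq> y" "x \<noteq> - y" using yS[OF that(1)] that(2) by (auto simp: pillar_def)
    then show ?thesis using inner_S[of y x] yS(1)[OF that(1)] that(2) by (auto simp: pillar_def)
  qed
  have yy: "inner y z \<le> (if y = z then 1 else 1/5)" if "y \<in> F" "z \<in> F" for y z
  proof (cases "y = z")
    case False
    have "z \<noteq> - y" using yS(2)[OF that(1)] yS(2)[OF that(2)] by auto
    then show ?thesis using inner_S[of y z] False yS(1) that by fastforce
  qed (use unit_S yS(1) that in auto)
  \<comment> \<open>With respect to the form \<open>4 I - 2 A\<close> of a star with five leaves and centre \<open>p\<close>, weight \<open>t\<close> at the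
    centre and 1 at the leaves has the value \<open>4 * t\<^sup>2 - 20 * t + 20\<close>, minimal at \<open>t = 5/2\<close>.\<close>
  define w where "w = (5/2) *\<^sub>R p + \<Sum>F"
  define m where "m = real (card ?V)"
  define d where "d x = (\<Sum>y\<in>F. if inner y x = 1/5 then 1 else 0 :: real)" for x
  define s where "s = (\<Sum>x\<in>?V. d x)"
  have "inner (\<Sum>F) (\<Sum>F) = (\<Sum>y\<in>F. \<Sum>z\<in>F. inner y z)"
    by (subst inner_sum_left) (simp add: inner_sum_right)
  also have "\<dots> \<le> (\<Sum>y\<in>F. \<Sum>z\<in>F. if y = z then 1 else 1/5)"
    by (intro sum_mono yy)
  also have "\<dots> = (\<Sum>y\<in>F. \<Sum>z\<in>F. 1/5 + (if y = z then 4/5 else 0))"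
    by (intro sum.cong) auto
  also have "\<dots> = 9"
    using F(2) finF by (simp add: sum.distrib)
  finally have FF: "inner (\<Sum>F) (\<Sum>F) \<le> 9" .
  have "inner p (\<Sum>F) = (\<Sum>y\<in>F. - 1/5)"
    unfolding inner_sum_right using yS(2) by (intro sum.cong) (auto simp: inner_commute)
  then have pF: "inner p (\<Sum>F) = - 1" using F(2) by simp
  have "inner w w = 25/4 * inner p p + 5 * inner p (\<Sum>F) + inner (\<Sum>F) (\<Sum>F)"
    by (simp add: w_def inner_add_left inner_add_right inner_commute)
  then have ww: "20 * inner w w \<le> 205"
    using FF pF unit_S[OF pq(1)] by simp
  have wx: "5 * inner w x = 2 * d x - 15/2" if "x \<in> ?V" for x
  proof -
    have "inner (\<Sum>F) x = (\<Sum>y\<in>F. 2/5 * (if inner y x = 1/5 then 1 else 0) - 1/5)"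
      unfolding inner_sum_left using yV that by (intro sum.cong) fastforce+
    also have "\<dots> = 2/5 * d x - 1"
      by (simp only: sum_subtractf sum_distrib_left[symmetric] d_def) (simp add: F(2))
    finally show ?thesis
      using that by (simp add: w_def inner_add_left inner_add_right pillar_def inner_commute)
  qed
  have "s = (\<Sum>y\<in>F. \<Sum>x\<in>?V. if inner y x = 1/5 then 1 else 0)"
    unfolding s_def d_def by (rule sum.swap)
  also have "\<dots> = (\<Sum>y\<in>F. real (card {x \<in> ?V. inner y x = 1/5}))"
    using finite_pillar by (simp add: sum.If_cases Int_def)
  also have "\<dots> \<le> (\<Sum>y\<in>F. 4)"
    using yS(4) by (intro sum_mono) fastforce
  finally have "s \<le> 20" using F(2) by simp
  have "0 \<le> s" unfolding s_def d_def by (intro sum_nonneg) auto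
  \<comment> \<open>\<open>d x\<close> is a natural number; this replaces the unknown \<open>\<Sum> (d x)\<^sup>2\<close> by \<open>s\<close> below.\<close>
  have dd: "d x \<le> (d x)\<^sup>2" for x
  proof -
    obtain n :: nat where "d x = real n"
    proof
      show "d x = real (card {y \<in> F. inner y x = 1/5})"
        unfolding d_def using finF by (simp add: sum.If_cases Int_def)
    qed
    moreover have "real n \<le> real (n * n)"
      unfolding of_nat_le_iff by (rule le_square)
    ultimately show ?thesis
      by (simp add: power2_eq_square)
  qed
  have s1: "(\<Sum>x\<in>?V. 5 * inner w x) = 2 * s - 15/2 * m"
    using wx by (simp add: sum_subtractf s_def m_def sum_distrib_left[symmetric])
  have "225/4 * m - 26 * s = (\<Sum>x\<in>?V. 225/4 - 26 * d x)"
    by (simp add: sum_subtractf s_def m_def sum_distrib_left[symmetric])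
  also have "\<dots> \<le> (\<Sum>x\<in>?V. (5 * inner w x)\<^sup>2)"
  proof (intro sum_mono)
    fix x assume "x \<in> ?V"
    show "225/4 - 26 * d x \<le> (5 * inner w x)\<^sup>2"
      unfolding wx[OF \<open>x \<in> ?V\<close>] using dd[of x] by (simp add: power2_eq_square algebra_simps)
  qed
  finally have s2: "225/4 * m - 26 * s \<le> (\<Sum>x\<in>?V. (5 * inner w x)\<^sup>2)" .
  have m: "56 \<le> m" using V56 by (simp add: m_def)
  have "225/4 * m - 26 * s - (2 * s - 15/2 * m)\<^sup>2 / (m + 4) \<le> 205"
    using bessel_pillar[OF pq, of w] s2 ww unfolding s1 of_nat_add m_def[symmetric] by simp
  then have "(225/4 * m - 26 * s) * (m + 4) - (2 * s - 15/2 * m)\<^sup>2 \<le> 205 * (m + 4)"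
    using m by (simp add: field_simps)
  then have "m * (5 + s) \<le> s\<^sup>2 + 26 * s + 205"
    by (simp add: algebra_simps power2_eq_square add_divide_distrib)
  moreover have "56 * (5 + s) \<le> m * (5 + s)"
    using m \<open>0 \<le> s\<close> by (intro mult_right_mono) auto
  moreover have "s * s \<le> 20 * s"
    using \<open>0 \<le> s\<close> \<open>s \<le> 20\<close> by (intro mult_right_mono)
  ultimately show False using \<open>0 \<le> s\<close> by (simp add: power2_eq_square)
qed

text \<open>A vanishing combination of \<open>V \<union> {p, q}\<close> has squared norm 0, and that norm is a sum of squares in
  which every coefficient occurs; thus \<open>V \<union> {p, q}\<close> is linearly independent.\<close>

lemma card_pillar_le_dim:
  assumes pq: "p \<in> S" "q \<in> S" "inner p q = - 1/5"
  shows "card (pillar p q) + 2 \<le> CARD('n)"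
proof -
  let ?V = "pillar p q"
  have notin: "p \<notin> ?V" "q \<notin> ?V" "p \<noteq> q"
    using pq unit_S[of p] unit_S[of q] by (auto simp: pillar_def)
  have "independent (insert p (insert q ?V))"
  proof (rule independent_if_scalars_zero)
    show "finite (insert p (insert q ?V))" using finite_pillar by simp
    fix f x assume 0: "(\<Sum>x\<in>insert p (insert q ?V). f x *\<^sub>R x) = 0" and x: "x \<in> insert p (insert q ?V)"
    let ?v = "\<Sum>x\<in>?V. f x *\<^sub>R x"
    define L where "L = (\<Sum>x\<in>?V. f x)"
    define Q where "Q = (\<Sum>x\<in>?V. (f x)\<^sup>2)"
    have sum0: "f p *\<^sub>R p + f q *\<^sub>R q + ?v = 0"
      using 0 notin finite_pillar by (simp add: add.assoc)
    have vv: "inner ?v ?v = 4/5 * Q + 1/5 * L\<^sup>2"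
      using inner_sum_constant_inner[of ?V "1/5" f, OF finite_pillar _ inner_pillar[OF pq]]
      by (simp add: pillar_def unit_S L_def Q_def)
    have pv: "inner p ?v = - 1/5 * L"
      unfolding inner_sum_right L_def sum_distrib_left
      by (intro sum.cong) (auto simp: pillar_def inner_commute)
    have qv: "inner q ?v = - 1/5 * L"
      unfolding inner_sum_right L_def sum_distrib_left
      by (intro sum.cong) (auto simp: pillar_def inner_commute)
    have "0 = inner (f p *\<^sub>R p + f q *\<^sub>R q + ?v) (f p *\<^sub>R p + f q *\<^sub>R q + ?v)"
      unfolding sum0 by simp
    also have "\<dots> = (f p)\<^sup>2 * inner p p + (f q)\<^sup>2 * inner q q + inner ?v ?v
        + 2 * f p * f q * inner p q + 2 * f p * inner p ?v + 2 * f q * inner q ?v"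
      by (simp add: inner_add_left inner_add_right inner_commute power2_eq_square algebra_simps)
    also have "\<dots> = 1/5 * (4 * Q + (L - f p - f q)\<^sup>2 + 2 * (f p - f q)\<^sup>2 + 2 * (f p)\<^sup>2 + 2 * (f q)\<^sup>2)"
      unfolding vv pv qv pq(3) unit_S[OF pq(1)] unit_S[OF pq(2)]
      by (simp add: power2_eq_square algebra_simps)
    finally have *: "4 * Q + (L - f p - f q)\<^sup>2 + 2 * (f p - f q)\<^sup>2 + 2 * (f p)\<^sup>2 + 2 * (f q)\<^sup>2 = 0"
      by simp
    have "0 \<le> Q" by (simp add: Q_def sum_nonneg)
    then have "Q = 0" "(f p)\<^sup>2 = 0" "(f q)\<^sup>2 = 0"
      using * zero_le_power2[of "L - f p - f q"] zero_le_power2[of "f p - f q"]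
        zero_le_power2[of "f p"] zero_le_power2[of "f q"] by linarith+
    then show "f x = 0"
      using x finite_pillar by (auto simp: Q_def sum_nonneg_eq_0_iff)
  qed
  then have "card (insert p (insert q ?V)) \<le> CARD('n)"
    using independent_bound by fastforce
  then show ?thesis using notin finite_pillar by simp
qed

text \<open>If the inner products with \<open>p\<close> and \<open>q\<close> agree, then \<open>y\<close> or \<open>- y\<close> is in the pillar. If they differ,
  negation exchanges the roles of \<open>p\<close> and \<open>q\<close> and also exchanges the positive with the negative
  inner products on the pillar, so one of the two sides is always available.\<close>

lemma signed_cover:
  assumes pq: "p \<in> S" "q \<in> S" "inner p q = - 1/5" and V: "46 \<le> card (pillar p q)" and y: "y \<in> S"
  shows "y \<in> pillar p q \<union> side p q \<union> side q p \<or> - y \<in> pillar p q \<union> side p q \<union> side q p"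
proof -
  have qp: "inner q p = - 1/5" using pq(3) by (simp add: inner_commute)
  have pS: "p \<in> side q p"
  proof -
    have no: "{x \<in> pillar q p. inner p x = 1/5} = {}" by (auto simp: pillar_def inner_commute)
    show ?thesis unfolding side_def mem_Collect_eq no using pq unit_S[of p] by simp
  qed
  have qS: "q \<in> side p q"
  proof -
    have no: "{x \<in> pillar p q. inner q x = 1/5} = {}" by (auto simp: pillar_def inner_commute)
    show ?thesis unfolding side_def mem_Collect_eq no using pq qp unit_S[of q] by simp
  qed
  have split: "z \<in> side p q \<or> - z \<in> side q p" if z: "z \<in> S" "inner z p = - 1/5" "inner z q = 1/5" for z
  proof -
    have "inner z x = 1/5 \<or> inner z x = - 1/5" if "x \<in> pillar p q" for x
    proof -
      have "x \<noteq> z" "x \<noteq> - z" using that z by (auto simp: pillar_def)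
      then show ?thesis using inner_S[of z x] z that by (auto simp: pillar_def)
    qed
    from few_of_one_sign[OF pq V unit_S[OF z(1)] this]
    show ?thesis
    proof
      assume "card {x \<in> pillar p q. inner z x = 1/5} \<le> 4"
      then show ?thesis using z by (simp add: side_def)
    next
      assume "card {x \<in> pillar p q. inner z x = - 1/5} \<le> 4"
      moreover have "{x \<in> pillar q p. inner (- z) x = 1/5} = {x \<in> pillar p q. inner z x = - 1/5}"
        by (auto simp: pillar_def)
      ultimately show ?thesis using z uminus_S by (simp add: side_def)
    qed
  qed
  consider "y = p \<or> y = - p \<or> y = q \<or> y = - q"
    | "(inner y p = 1/5 \<or> inner y p = - 1/5) \<and> (inner y q = 1/5 \<or> inner y q = - 1/5)"
    using inner_S[OF y pq(1)] inner_S[OF y pq(2)] by fastforce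
  then show ?thesis
  proof cases
    case 1
    then show ?thesis using pS qS by auto
  next
    case 2
    then show ?thesis
      using split[of y] split[of "- y"] y uminus_S[OF y] by (auto simp: pillar_def)
  qed
qed

lemma card_le_if_large_pillar:
  assumes pq: "p \<in> S" "q \<in> S" "inner p q = - 1/5" and V: "56 \<le> card (pillar p q)"
  shows "card S \<le> 2 * (CARD('n) + 6)"
proof -
  have qp: "inner q p = - 1/5" using pq(3) by (simp add: inner_commute)
  let ?T = "pillar p q \<union> side p q \<union> side q p"
  have fin: "finite ?T" using finite_S by (simp add: pillar_def side_def)
  have "card ?T \<le> card (pillar p q) + card (side p q) + card (side q p)"
    by (meson add_le_mono1 card_Un_le le_trans)
  also have "\<dots> \<le> card (pillar p q) + 4 + 4"
    using card_side_le_4[OF pq V] card_side_le_4[OF pq(2,1) qp] V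
    by (intro add_mono) (simp_all add: pillar_commute)
  also have "\<dots> \<le> CARD('n) + 6" using card_pillar_le_dim[OF pq] by simp
  finally have "card ?T \<le> CARD('n) + 6" .
  moreover have "card S \<le> 2 * card ?T"
    using signed_cover[OF pq] V by (intro card_signed_cover fin) auto
  ultimately show ?thesis by simp
qed

lemma card_le:
  assumes p: "p1 \<in> S" "p2 \<in> S" "p3 \<in> S"
    and inner: "inner p1 p2 = - 1/5" "inner p1 p3 = - 1/5" "inner p2 p3 = - 1/5"
  shows "card S \<le> 2 * max 165 (CARD('n) + 6)"
proof (cases "56 \<le> card (pillar p1 p2) \<or> 56 \<le> card (pillar p1 p3) \<or> 56 \<le> card (pillar p2 p3)")
  case True
  then have "card S \<le> 2 * (CARD('n) + 6)"
    using card_le_if_large_pillar p inner by blast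
  then show ?thesis by (auto simp: max_def)
next
  case False
  let ?T = "pillar p1 p2 \<union> pillar p1 p3 \<union> pillar p2 p3"
  have inner': "inner p2 p1 = - 1/5" "inner p3 p1 = - 1/5" "inner p3 p2 = - 1/5"
    using inner by (simp_all add: inner_commute)
  have base: "p1 \<in> ?T" "p2 \<in> ?T" "p3 \<in> ?T"
    using p inner inner' by (auto simp: pillar_def)
  have "y \<in> ?T \<or> - y \<in> ?T" if y: "y \<in> S" for y
  proof (cases "y \<in> {p1, p2, p3, - p1, - p2, - p3}")
    case True
    then show ?thesis using base by auto
  next
    case False
    then have sgn: "inner y p = 1/5 \<or> inner y p = - 1/5" if "p \<in> {p1, p2, p3}" for p
      using inner_S[OF y, of p] that p by fastforce
    have "\<not> (inner y p1 = - 1/5 \<and> inner y p2 = - 1/5 \<and> inner y p3 = - 1/5)"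
      using no_quadruple[of y p1 p2 p3] y p inner by auto
    moreover have "\<not> (inner y p1 = 1/5 \<and> inner y p2 = 1/5 \<and> inner y p3 = 1/5)"
      using no_quadruple[of "- y" p1 p2 p3] uminus_S[OF y] p inner by auto
    ultimately show ?thesis
      using sgn[of p1] sgn[of p2] sgn[of p3] y uminus_S[OF y] by (auto simp: pillar_def)
  qed
  then have "card S \<le> 2 * card ?T"
    by (intro card_signed_cover) (auto simp: finite_pillar)
  also have "card ?T \<le> card (pillar p1 p2) + card (pillar p1 p3) + card (pillar p2 p3)"
    by (meson add_le_mono1 card_Un_le le_trans)
  also have "\<dots> \<le> 165" using False by simp
  finally show ?thesis by (auto simp: max_def)
qed

end

section \<open>The base size in terms of signed vectors\<close>

lemma index_mult_mat_sum:
  assumes "A \<in> carrier_mat k k" "B \<in> carrier_mat k k" "i < k" "j < k"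
  shows "(A * B) $$ (i, j) = (\<Sum>t<k. A $$ (i, t) * B $$ (t, j))"
proof -
  have "(A * B) $$ (i, j) = Matrix.row A i \<bullet> Matrix.col B j"
    using assms by auto
  also have "\<dots> = (\<Sum>t<k. A $$ (i, t) * B $$ (t, j))"
    unfolding scalar_prod_def using assms by (intro sum.cong) auto
  finally show ?thesis .
qed

text \<open>Conjugation by \<open>C B\<close> reorders the rows and columns along \<open>f\<close> and then multiplies them by signs:
  it turns the Gram matrix of a list into that of the reordered list with changed signs.\<close>

lemma signed_permutation_conjugate:
  fixes G :: "real mat"
  assumes G: "G \<in> carrier_mat k k" and B: "signed_diagonal_mat k B"
    and bij: "bij_betw f {..<k} {..<k}" and C: "C = Matrix.mat k k (\<lambda>(i, j). if i = f j then 1 else 0)"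
    and ij: "i < k" "j < k"
  shows "(transpose_mat (C * B) * G * (C * B)) $$ (i, j) = B $$ (i, i) * B $$ (j, j) * G $$ (f i, f j)"
proof -
  have B': "B \<in> carrier_mat k k" "\<And>i j. i < k \<Longrightarrow> j < k \<Longrightarrow> i \<noteq> j \<Longrightarrow> B $$ (i, j) = 0"
    using B by (auto simp: signed_diagonal_mat_def diagonal_mat_def)
  have f: "f i < k" if "i < k" for i using bij that by (auto simp: bij_betw_def)
  have C': "C \<in> carrier_mat k k" by (simp add: C)
  define D where "D = C * B"
  have D: "D \<in> carrier_mat k k" unfolding D_def using C' B'(1) by (rule mult_carrier_mat)
  then have D': "transpose_mat D \<in> carrier_mat k k" by simp
  have CB: "D $$ (l, j) = (if l = f j then B $$ (j, j) else 0)" if "l < k" "j < k" for l j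
  proof -
    have "D $$ (l, j) = (\<Sum>t<k. C $$ (l, t) * B $$ (t, j))"
      unfolding D_def using C' B'(1) that by (rule index_mult_mat_sum)
    also have "\<dots> = (\<Sum>t<k. if t = j then (if l = f j then B $$ (j, j) else 0) else 0)"
      using B' that by (intro sum.cong) (auto simp: C)
    finally show ?thesis using that by simp
  qed
  have TG: "(transpose_mat D * G) $$ (i, t) = B $$ (i, i) * G $$ (f i, t)" if "t < k" for t
  proof -
    have "(transpose_mat D * G) $$ (i, t) = (\<Sum>l<k. transpose_mat D $$ (i, l) * G $$ (l, t))"
      using D' G ij(1) that by (rule index_mult_mat_sum)
    also have "\<dots> = (\<Sum>l<k. if l = f i then B $$ (i, i) * G $$ (f i, t) else 0)"
      using CB D ij by (intro sum.cong) auto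
    finally show ?thesis using f ij by simp
  qed
  have "(transpose_mat D * G * D) $$ (i, j) = (\<Sum>t<k. (transpose_mat D * G) $$ (i, t) * D $$ (t, j))"
    using mult_carrier_mat[OF D' G] D ij by (rule index_mult_mat_sum)
  also have "\<dots> = (\<Sum>t<k. if t = f j then B $$ (i, i) * B $$ (j, j) * G $$ (f i, f j) else 0)"
    using TG CB ij by (intro sum.cong) auto
  finally show ?thesis using f ij by (simp add: D_def)
qed

definition simplex_list :: "real \<Rightarrow> (real ^ 'n) set \<Rightarrow> (real ^ 'n) list \<Rightarrow> bool" where
  "simplex_list a X qs \<longleftrightarrow> set qs \<subseteq> X \<union> uminus ` X \<and>
     (\<forall>i<length qs. \<forall>j<length qs. i \<noteq> j \<longrightarrow> inner (qs ! i) (qs ! j) = - a)"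

text \<open>This removes all matrices from the base size. Given \<open>ps\<close>, the list \<open>qs\<close> is obtained by applying the
  permutation and the signs; given \<open>qs\<close>, the signs are chosen to move each entry back into \<open>X\<close>, and
  the identity serves as permutation.\<close>

lemma gram_equiv_simplex_iff:
  fixes X :: "(real ^ 'n) set"
  assumes unit: "\<And>x. x \<in> X \<Longrightarrow> inner x x = 1"
  shows "(\<exists>ps. length ps = k \<and> set ps \<subseteq> X \<and>
            gram_equiv (gram_mat ps) ((1 + a) \<cdot>\<^sub>m 1\<^sub>m k - a \<cdot>\<^sub>m all_ones_mat k))
         \<longleftrightarrow> (\<exists>qs. length qs = k \<and> simplex_list a X qs)"
    (is "?L \<longleftrightarrow> ?R")
proof
  let ?M = "(1 + a) \<cdot>\<^sub>m 1\<^sub>m k - a \<cdot>\<^sub>m all_ones_mat k"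
  assume ?L
  then obtain ps where ps: "length ps = k" "set ps \<subseteq> X" "gram_equiv (gram_mat ps) ?M" by blast
  then obtain k' B C where k': "gram_mat ps \<in> carrier_mat k' k'" and B: "signed_diagonal_mat k' B"
    and C: "permutation_mat k' C" and M: "?M = transpose_mat (C * B) * gram_mat ps * (C * B)"
    unfolding gram_equiv_def by blast
  have [simp]: "k' = k" using carrier_matD(1)[OF k'] ps(1) by (simp add: gram_mat_def)
  from C obtain f where f: "bij_betw f {..<k} {..<k}"
    "C = Matrix.mat k k (\<lambda>(i, j). if i = f j then 1 else 0)"
    by (auto simp: permutation_mat_def)
  have fk: "f i < k" if "i < k" for i using f(1) that by (auto simp: bij_betw_def)
  define qs where "qs = map (\<lambda>i. B $$ (i, i) *\<^sub>R ps ! f i) [0..<k]"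
  have "inner (qs ! i) (qs ! j) = - a" if ij: "i < k" "j < k" "i \<noteq> j" for i j
  proof -
    have "?M $$ (i, j) = B $$ (i, i) * B $$ (j, j) * gram_mat ps $$ (f i, f j)"
      unfolding M using k' B f ij by (intro signed_permutation_conjugate) simp_all
    moreover have "?M $$ (i, j) = - a" using ij by (simp add: all_ones_mat_def)
    ultimately show ?thesis using ij fk ps(1) by (simp add: qs_def gram_mat_def)
  qed
  moreover have "set qs \<subseteq> X \<union> uminus ` X"
  proof
    fix x assume "x \<in> set qs"
    then obtain i where i: "i < k" "x = B $$ (i, i) *\<^sub>R ps ! f i" by (auto simp: qs_def)
    then have "ps ! f i \<in> X" using fk ps by auto
    moreover have "B $$ (i, i) = - 1 \<or> B $$ (i, i) = 1"
      using B i by (auto simp: signed_diagonal_mat_def)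
    ultimately show "x \<in> X \<union> uminus ` X" using i by auto
  qed
  ultimately show ?R by (intro exI[of _ qs]) (simp add: qs_def simplex_list_def)
next
  let ?M = "(1 + a) \<cdot>\<^sub>m 1\<^sub>m k - a \<cdot>\<^sub>m all_ones_mat k"
  assume ?R
  then obtain qs where qs: "length qs = k" "set qs \<subseteq> X \<union> uminus ` X"
    "\<And>i j. i < k \<Longrightarrow> j < k \<Longrightarrow> i \<noteq> j \<Longrightarrow> inner (qs ! i) (qs ! j) = - a"
    by (auto simp: simplex_list_def)
  define e where "e q = (if q \<in> X then 1 else - 1 :: real)" for q
  define ps where "ps = map (\<lambda>q. e q *\<^sub>R q) qs"
  define B where "B = Matrix.mat k k (\<lambda>(i, j). if i = j then e (qs ! i) else 0)"
  define C :: "real mat" where "C = Matrix.mat k k (\<lambda>(i, j). if i = id j then 1 else 0)"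
  have len: "length ps = k" using qs(1) by (simp add: ps_def)
  have ee: "e q * e q = 1" for q by (simp add: e_def)
  have B: "signed_diagonal_mat k B"
    by (auto simp: signed_diagonal_mat_def diagonal_mat_def B_def e_def)
  have C: "permutation_mat k C" unfolding permutation_mat_def C_def by (intro exI[of _ id]) simp
  have G: "gram_mat ps \<in> carrier_mat k k" using len by (simp add: gram_mat_def)
  have "?M = transpose_mat (C * B) * gram_mat ps * (C * B)"
  proof (rule eq_matI)
    fix i j
    assume "i < dim_row (transpose_mat (C * B) * gram_mat ps * (C * B))"
      "j < dim_col (transpose_mat (C * B) * gram_mat ps * (C * B))"
    then have ij: "i < k" "j < k" by (simp_all add: B_def)
    have "(transpose_mat (C * B) * gram_mat ps * (C * B)) $$ (i, j)
        = B $$ (i, i) * B $$ (j, j) * gram_mat ps $$ (id i, id j)"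
      using G B C_def ij by (intro signed_permutation_conjugate) (simp_all add: bij_betw_def)
    also have "\<dots> = (e (qs ! i) * e (qs ! i)) * (e (qs ! j) * e (qs ! j)) * inner (qs ! i) (qs ! j)"
      using ij qs(1) len by (simp add: B_def gram_mat_def ps_def)
    also have "\<dots> = inner (qs ! i) (qs ! j)" by (simp add: ee)
    also have "\<dots> = ?M $$ (i, j)"
    proof (cases "i = j")
      case True
      have "qs ! i \<in> X \<union> uminus ` X" using qs(1,2) ij by (meson nth_mem subsetD)
      then have "inner (qs ! i) (qs ! i) = 1" using unit by auto
      then show ?thesis using True ij by (simp add: all_ones_mat_def)
    qed (use ij qs(3) in \<open>simp add: all_ones_mat_def\<close>)
    finally show "?M $$ (i, j) = (transpose_mat (C * B) * gram_mat ps * (C * B)) $$ (i, j)" ..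
  qed (simp_all add: B_def all_ones_mat_def)
  then have "gram_equiv (gram_mat ps) ?M"
    unfolding gram_equiv_def using G B C by blast
  moreover have "set ps \<subseteq> X" using qs(2) by (auto simp: ps_def e_def)
  ultimately show ?L using len by blast
qed

text \<open>The maximum in the definition of the base size is attained and is an upper bound, because the
  admissible lengths are bounded: entries of a list of the kind considered are pairwise distinct,
  as \<open>- a \<noteq> 1\<close>.\<close>

lemma base_size_simplex_list:
  fixes X :: "(real ^ 'n) set"
  assumes X: "equiangular a X"
  shows "\<exists>qs. length qs = base_size a X \<and> simplex_list a X qs"
    and "simplex_list a X qs \<Longrightarrow> length qs \<le> base_size a X"
proof -
  have unit: "inner x x = 1" if "x \<in> X" for x
    using X that by (simp add: equiangular_def norm_eq_1)
  let ?K = "{k. \<exists>qs. length qs = k \<and> simplex_list a X qs}"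
  have K: "base_size a X = Max ?K"
    unfolding base_size_def by (intro arg_cong[where f = Max] Collect_cong gram_equiv_simplex_iff unit)
  have "length qs \<le> card (X \<union> uminus ` X)" if qs: "simplex_list a X qs" for qs
  proof -
    have "distinct qs"
      unfolding distinct_conv_nth
    proof (intro allI impI notI)
      fix i j assume ij: "i < length qs" "j < length qs" "i \<noteq> j" "qs ! i = qs ! j"
      then have "inner (qs ! i) (qs ! i) = - a" using qs by (metis simplex_list_def)
      moreover have "qs ! i \<in> X \<union> uminus ` X" using qs ij(1) unfolding simplex_list_def by (meson nth_mem subsetD)
      then have "inner (qs ! i) (qs ! i) = 1" using unit by auto
      ultimately show False using X by (simp add: equiangular_def)
    qed
    then have "length qs = card (set qs)" by (simp add: distinct_card)
    also have "\<dots> \<le> card (X \<union> uminus ` X)"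
      using qs X by (intro card_mono) (auto simp: simplex_list_def equiangular_def)
    finally show ?thesis .
  qed
  then have "?K \<subseteq> {..card (X \<union> uminus ` X)}" by auto
  then have fin: "finite ?K" by (rule finite_subset) simp
  have "simplex_list a X []" by (simp add: simplex_list_def)
  then have "?K \<noteq> {}" by blast
  from Max_in[OF fin this] show "\<exists>qs. length qs = base_size a X \<and> simplex_list a X qs"
    unfolding K by simp
  show "simplex_list a X qs \<Longrightarrow> length qs \<le> base_size a X"
    unfolding K using fin by (intro Max_ge) auto
qed

text \<open>A vector and its negative have inner product \<open>- 1\<close>, which is excluded in \<open>X\<close> by \<open>a < 1\<close>.\<close>

lemma card_symmetric_closure:
  fixes X :: "(real ^ 'n) set"
  assumes X: "equiangular a X"
  shows "card (X \<union> uminus ` X) = 2 * card X"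
proof -
  have "X \<inter> uminus ` X = {}"
  proof (rule ccontr)
    assume "\<not> ?thesis"
    then obtain x where x: "x \<in> X" "- x \<in> X" by auto
    have a: "0 \<le> a" "a < 1" and "norm x = 1"
      and pair: "\<forall>x\<in>X. \<forall>y\<in>X. x \<noteq> y \<longrightarrow> inner x y \<in> {- a, a}"
      using X x(1) unfolding equiangular_def by blast+
    from \<open>norm x = 1\<close> have xx: "inner x x = 1" by (simp add: norm_eq_1)
    have "inner x x \<noteq> inner x (- x)" using xx by simp
    then have "x \<noteq> - x" by metis
    then have "inner x (- x) \<in> {- a, a}" using pair x by blast
    then show False using a xx by auto
  qed
  moreover have "card (uminus ` X) = card X" by (simp add: card_image)
  ultimately show ?thesis
    using X by (subst card_Un_disjoint) (auto simp: equiangular_def)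
qed

theorem theorem4p3:
  fixes X :: "(real ^ 'n) set"
  assumes "equiangular (1 / 5) X"
    and "base_size (1 / 5) X = 3"
  shows "card X \<le> max 165 (CARD('n) + 6)"
proof -
  let ?S = "X \<union> uminus ` X"
  have X: "finite X" "\<And>x. x \<in> X \<Longrightarrow> inner x x = 1"
    "\<And>x y. x \<in> X \<Longrightarrow> y \<in> X \<Longrightarrow> x \<noteq> y \<Longrightarrow> inner x y = 1/5 \<or> inner x y = - 1/5"
    using assms(1) by (auto simp: equiangular_def norm_eq_1)
  interpret equiangular_fifth ?S
  proof
    show "finite ?S" using X(1) by simp
    show "- x \<in> ?S" if "x \<in> ?S" for x using that by auto
    show "inner x x = 1" if "x \<in> ?S" for x using that X(2) by auto
    show "inner x y = 1/5 \<or> inner x y = - 1/5" 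
      if xy: "x \<in> ?S" "y \<in> ?S" "y \<noteq> x" "y \<noteq> - x" for x y
    proof -
      obtain u v where "u \<in> X" "v \<in> X" "x = u \<or> x = - u" "y = v \<or> y = - v"
        using xy(1,2) by blast
      moreover from this have "u \<noteq> v" using xy(3,4) by auto
      ultimately show ?thesis using X(3)[of u v] by auto
    qed
    show False if "w \<in> ?S" "x \<in> ?S" "y \<in> ?S" "z \<in> ?S"
       "inner w x = - 1/5" "inner w y = - 1/5" "inner w z = - 1/5"
       "inner x y = - 1/5" "inner x z = - 1/5" "inner y z = - 1/5" for w x y z
    proof -
      have "simplex_list (1/5) X [w, x, y, z]"
        using that by (auto simp: simplex_list_def less_Suc_eq numeral_eq_Suc inner_commute)
      from base_size_simplex_list(2)[OF assms(1) this] show False using assms(2) by simp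
    qed
  qed
  obtain qs where qs: "length qs = 3" "simplex_list (1/5) X qs"
    using base_size_simplex_list(1)[OF assms(1)] assms(2) by metis
  have "card ?S \<le> 2 * max 165 (CARD('n) + 6)"
  proof (rule card_le)
    have "qs ! i \<in> ?S" if "i < 3" for i
      using qs that unfolding simplex_list_def by (metis nth_mem subsetD)
    then show "qs ! 0 \<in> ?S" "qs ! 1 \<in> ?S" "qs ! 2 \<in> ?S" by simp_all
    show "inner (qs ! 0) (qs ! 1) = - 1/5" "inner (qs ! 0) (qs ! 2) = - 1/5"
      "inner (qs ! 1) (qs ! 2) = - 1/5"
      using qs by (simp_all add: simplex_list_def)
  qed
  then show ?thesis using card_symmetric_closure[OF assms(1)] by simp
qed

end
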